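(* Let $N\in\mathbb{I}_{\ge1}$, $\epsilon_{\mathrm{o}}\in(0,1)$, $\eta:=1-\epsilon_{\mathrm{o}}$, and let $\overline\gamma_{\mathrm{f}}\ge0$, $\gamma_{k,\mathrm{f}}\in[0,\overline\gamma_{\mathrm{f}}]$, $k\in\mathbb{I}_{\ge1}$, and $\underline c_{\mathrm{f}},\overline c_{\mathrm{f}},\epsilon_{\mathrm{f}}>0$ be constants with $\underline c_{\mathrm{f}}\le\frac{\gamma_{1,\mathrm{f}}}{1+\epsilon_{\mathrm{f}}}\le\overline c_{\mathrm{f}}$. Let $\underline\gamma_{\mathrm{o}}=\overline\gamma_{\mathrm{o}}=1$, and let $\alpha_{N,\mathrm{f}}$ be defined by the linear program $$(\alpha_{N,\mathrm{f}}-1)\epsilon_{\mathrm{o}}:=\min_{\tilde\ell,\tilde W,\tilde\sigma,\tilde V,\tilde V_{\mathrm{f}}}\ \sum_{k=1}^{N-1}\tilde\ell_k+\tilde V_{\mathrm{f}}-\tilde V$$ over real variables $\tilde\ell_k$ ($k\in\mathbb{I}_{[0,N-1]}$), $\tilde W_k,\tilde\sigma_k$ ($k\in\mathbb{I}_{[0,N]}$), $\tilde V$, $\tilde V_{\mathrm{f}}$, subject to \begin{align*} &\tilde\sigma_0=1,\quad \tilde\ell_k\ge0,\ k\in\mathbb{I}_{[0,N-1]},\quad \tilde V_{\mathrm{f}}\ge0,\quad \tilde\sigma_k\ge0,\ \tilde W_k\ge0,\ k\in\mathbb{I}_{[0,N]},\\ &\underline{\gamma}_{\mathrm{o}}\tilde\sigma_k\le\tilde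 W_k\le\overline{\gamma}_{\mathrm{o}}\tilde\sigma_k,\ k\in\mathbb{I}_{[0,N]},\\ &\tilde W_{k+1}-\tilde W_k\le-\epsilon_{\mathrm{o}}\tilde\sigma_k+\tilde\ell_k,\ k\in\mathbb{I}_{[0,N-1]},\\ &\textstyle\sum_{j=k}^{N-1}\tilde\ell_j+\tilde V_{\mathrm{f}}\le\gamma_{N-k,\mathrm{f}}\tilde\sigma_k,\ k\in\mathbb{I}_{[0,N-1]},\\ &\textstyle\tilde V\le\sum_{j=1}^{k-1}\tilde\ell_j+\gamma_{N-k+1,\mathrm{f}}\tilde\sigma_k,\ k\in\mathbb{I}_{[1,N]},\\ &\textstyle\tilde V\le\sum_{j=1}^{N-1}\tilde\ell_j+(1+\epsilon_{\mathrm{f}})\tilde V_{\mathrm{f}},\\ &\underline c_{\mathrm{f}}\tilde\sigma_N\le\tilde V_{\mathrm{f}}\le\overline c_{\mathrm{f}}\tilde\sigma_N. \end{align*} Define $\hat\alpha_{N,\mathrm{f}}$ by $$(1-\hat\alpha_{N,\mathrm{f}})\epsilon_{\mathrm{o}}:=\frac{\epsilon_{\mathrm{f}}\gamma_{1,\mathrm{f}}(\gamma_{N,\mathrm{f}}+\eta)\prod_{j=0}^{N-2}(\eta+\gamma_{N-j,\mathrm{f}})}{(1+\epsilon_{\mathrm{f}})\prod_{j=0}^{N-1}(1+\gamma_{N-j,\mathrm{f}})-\epsilon_{\mathrm{f}}\gamma_{1,\mathrm{f}}\prod_{j=0}^{N-2}(\eta+\gamma_{N-j,\mathrm{f}})}.$$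 Then: (i) $(1-\alpha_{N,\mathrm{f}})\epsilon_{\mathrm{o}}\le(1-\hat\alpha_{N,\mathrm{f}})\epsilon_{\mathrm{o}}$; (ii) $\alpha_{N,\mathrm{f}}>0$ holds if $$N>\underline N_{\mathrm{f}}:=1+\frac{\log(\overline\gamma_{\mathrm{f}})-\log(\epsilon_{\mathrm{o}})-\log(1+1/\epsilon_{\mathrm{f}})}{\log(1+\overline\gamma_{\mathrm{f}})-\log(\overline\gamma_{\mathrm{f}}+\eta)};$$ (iii) if additionally $\gamma_{k,\mathrm{f}}=\overline\gamma_{\mathrm{f}}$ for all $k\in\mathbb{I}_{\ge1}$, then $\hat\alpha_{N,\mathrm{f}}=\alpha_{N,\mathrm{f}}$.
   Context: $\mathbb{I}_{[a,b]}$ (resp. $\mathbb{I}_{\ge a}$) denotes the integers in $[a,b]$ (resp. $\ge a$). Empty sums are $0$ and empty products are $1$. *)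

theory Defs
  imports "HOL-Analysis.Analysis"
begin

text \<open>
  The finitely many variables \<open>l\<^sub>0, \<dots>, l\<^sub>N\<^sub>-\<^sub>1\<close>, \<open>W\<^sub>0, \<dots>, W\<^sub>N\<close>, \<open>\<sigma>\<^sub>0, \<dots>, \<sigma>\<^sub>N\<close> are represented
  by functions on \<^typ>\<open>nat\<close> whose values outside the stated index ranges are
  not referred to by any constraint or by the objective.
  The arguments \<open>go_lo\<close>, \<open>go_up\<close> stand for the lower and upper constants \<open>\<gamma>\<^sub>o\<close>,
  \<open>c_lo\<close>, \<open>c_up\<close> for the lower and upper constants \<open>c\<^sub>f\<close>, and \<open>\<gamma> k\<close> for \<open>\<gamma>\<^sub>k\<^sub>,\<^sub>f\<close>.
\<close>

definition lp_feasible ::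
  "nat \<Rightarrow> real \<Rightarrow> real \<Rightarrow> real \<Rightarrow> (nat \<Rightarrow> real) \<Rightarrow> real \<Rightarrow> real \<Rightarrow> real \<Rightarrow>
   (nat \<Rightarrow> real) \<Rightarrow> (nat \<Rightarrow> real) \<Rightarrow> (nat \<Rightarrow> real) \<Rightarrow> real \<Rightarrow> real \<Rightarrow> bool" where
  "lp_feasible N \<epsilon>\<^sub>o go_lo go_up \<gamma> c_lo c_up \<epsilon>\<^sub>f l W \<sigma> V V\<^sub>f \<longleftrightarrow>
     \<sigma> 0 = 1 \<and> (\<forall>k<N. 0 \<le> l k) \<and> 0 \<le> V\<^sub>f \<and> (\<forall>k\<le>N. 0 \<le> \<sigma> k \<and> 0 \<le> W k) \<and>
     (\<forall>k\<le>N. go_lo * \<sigma> k \<le> W k \<and> W k \<le> go_up * \<sigma> k) \<and>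
     (\<forall>k<N. W (k + 1) - W k \<le> - \<epsilon>\<^sub>o * \<sigma> k + l k) \<and>
     (\<forall>k<N. (\<Sum>j=k..<N. l j) + V\<^sub>f \<le> \<gamma> (N - k) * \<sigma> k) \<and>
     (\<forall>k\<in>{1..N}. V \<le> (\<Sum>j=1..<k. l j) + \<gamma> (N - k + 1) * \<sigma> k) \<and>
     V \<le> (\<Sum>j=1..<N. l j) + (1 + \<epsilon>\<^sub>f) * V\<^sub>f \<and>
     c_lo * \<sigma> N \<le> V\<^sub>f \<and> V\<^sub>f \<le> c_up * \<sigma> N"

definition lp_values ::
  "nat \<Rightarrow> real \<Rightarrow> real \<Rightarrow> real \<Rightarrow> (nat \<Rightarrow> real) \<Rightarrow> real \<Rightarrow> real \<Rightarrow> real \<Rightarrow> real set" where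
  "lp_values N \<epsilon>\<^sub>o go_lo go_up \<gamma> c_lo c_up \<epsilon>\<^sub>f =
     {(\<Sum>k=1..<N. l k) + V\<^sub>f - V | l W \<sigma> V V\<^sub>f.
        lp_feasible N \<epsilon>\<^sub>o go_lo go_up \<gamma> c_lo c_up \<epsilon>\<^sub>f l W \<sigma> V V\<^sub>f}"

text \<open>
  The minimum is a genuine least element rather than an infimum: nothing is known
  about the value of \<open>LEAST\<close> unless the minimum is shown to be attained.
\<close>

definition lp_min ::
  "nat \<Rightarrow> real \<Rightarrow> real \<Rightarrow> real \<Rightarrow> (nat \<Rightarrow> real) \<Rightarrow> real \<Rightarrow> real \<Rightarrow> real \<Rightarrow> real" where
  "lp_min N \<epsilon>\<^sub>o go_lo go_up \<gamma> c_lo c_up \<epsilon>\<^sub>f =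
     (LEAST v. v \<in> lp_values N \<epsilon>\<^sub>o go_lo go_up \<gamma> c_lo c_up \<epsilon>\<^sub>f)"

end

theory Submission
  imports Defs
begin

text \<open>
  Write \<open>S\<^sub>k = l\<^sub>k + \<dots> + l\<^sub>N\<^sub>-\<^sub>1 + V\<^sub>f\<close> for the cost that remains at stage \<open>k\<close> and
  \<open>D = V - S\<^sub>1\<close> for the negated objective, so that \<open>(1 - \<alpha>) \<epsilon>\<^sub>o\<close> is the largest
  feasible \<open>D\<close>. With both constants \<open>\<gamma>\<^sub>o\<close> equal to 1 the constraints force \<open>W = \<sigma>\<close>, and the
  linear program becomes
  \<open>\<sigma>\<^sub>k\<^sub>+\<^sub>1 + S\<^sub>k\<^sub>+\<^sub>1 \<le> \<eta> \<sigma>\<^sub>k + S\<^sub>k\<close> (dynamics),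
  \<open>D + S\<^sub>k \<le> \<gamma>\<^sub>N\<^sub>-\<^sub>k\<^sub>+\<^sub>1 \<sigma>\<^sub>k\<close> (value bounds), \<open>S\<^sub>k \<le> \<gamma>\<^sub>N\<^sub>-\<^sub>k \<sigma>\<^sub>k\<close> and \<open>D \<le> \<epsilon>\<^sub>f S\<^sub>N\<close>; this is
  \<open>lp_feasible_iff\<close>.

  Upper bound. Let \<open>P\<^sub>k = \<eta> \<sigma>\<^sub>k + S\<^sub>k\<close>. Dynamics and value bound together give the contraction
  \<open>(1 + \<gamma>\<^sub>N\<^sub>-\<^sub>k) (P\<^sub>k\<^sub>+\<^sub>1 + D) \<le> (\<eta> + \<gamma>\<^sub>N\<^sub>-\<^sub>k) (P\<^sub>k + D)\<close>, starting from
  \<open>P\<^sub>0 \<le> \<eta> + \<gamma>\<^sub>N\<close>. At the last stage, \<open>D \<le> \<epsilon>\<^sub>f S\<^sub>N\<close> turns the value bound into an upper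
  bound of \<open>D\<close> by a multiple of \<open>P\<^sub>N\<^sub>-\<^sub>1 + D\<close>. Chaining these estimates
  gives an inequality that is linear in \<open>D\<close>
  (\<open>feasible_gap_inequality\<close>), and solving it for \<open>D\<close> yields exactly \<open>(1 - \<alpha>_hat) \<epsilon>\<^sub>o\<close>.

  Horizon bound. Enlarging all \<open>\<gamma>\<^sub>k\<close> to \<open>\<gamma>_bar\<close> only relaxes the constraints, so the same
  inequality holds with \<open>\<gamma>_bar\<close> throughout. If \<open>D \<ge> \<epsilon>\<^sub>o\<close>, it would force
  \<open>\<epsilon>\<^sub>o (1 + \<epsilon>\<^sub>f) (1 + \<gamma>_bar)\<^bsup>N-1\<^esup> \<le> \<epsilon>\<^sub>f \<gamma>_bar (\<eta> + \<gamma>_bar)\<^bsup>N-1\<^esup>\<close>, whose negation is, after taking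
  logarithms, the lower bound on \<open>N\<close>.

  Constant case. Making every inequality in the chain an equality determines \<open>\<sigma>\<close> and
  \<open>S\<close> as geometric sequences; for constant \<open>\<gamma>\<close> the resulting point is feasible
  (\<open>constant_bound_attained\<close>), so the upper bound is sharp.

  All three parts need the minimum of the program to exist; this is a compactness argument
  (\<open>lp_values_attains_min\<close>).
\<close>

section \<open>The program in terms of the remaining cost\<close>

definition tail_cost :: "nat \<Rightarrow> (nat \<Rightarrow> real) \<Rightarrow> real \<Rightarrow> nat \<Rightarrow> real" where
  "tail_cost N l V\<^sub>f k = (\<Sum>j=k..<N. l j) + V\<^sub>f"

lemma tail_cost_Suc: "k < N \<Longrightarrow> tail_cost N l V\<^sub>f k = l k + tail_cost N l V\<^sub>f (Suc k)"
  by (simp add: tail_cost_def sum.atLeast_Suc_lessThan)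

lemma tail_cost_end [simp]: "tail_cost N l V\<^sub>f N = V\<^sub>f"
  by (simp add: tail_cost_def)

lemma tail_cost_head:
  assumes "1 \<le> k" "k \<le> N"
  shows "tail_cost N l V\<^sub>f 1 = (\<Sum>j=1..<k. l j) + tail_cost N l V\<^sub>f k"
  using assms by (simp add: tail_cost_def sum.atLeastLessThan_concat)

text \<open>
  Subtracting \<open>S\<^sub>1\<close> from the bounds on \<open>V\<close> replaces their partial sums by \<open>S\<^sub>k\<close>, so that
  \<open>V\<close> enters only through the gap \<open>V - S\<^sub>1\<close>. The index of the value bounds is shifted to
  run over \<open>k < N\<close> like that of the dynamics, ready for a common induction.
\<close>

lemma lp_feasible_iff:
  assumes "1 \<le> N"
  shows "lp_feasible N \<epsilon>\<^sub>o 1 1 \<gamma> c_lo c_up \<epsilon>\<^sub>f l W \<sigma> V V\<^sub>f \<longleftrightarrow>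
     \<sigma> 0 = 1 \<and> (\<forall>k<N. 0 \<le> l k) \<and> 0 \<le> V\<^sub>f \<and> (\<forall>k\<le>N. 0 \<le> \<sigma> k \<and> W k = \<sigma> k) \<and>
     (\<forall>k<N. \<sigma> (Suc k) + tail_cost N l V\<^sub>f (Suc k) \<le> (1 - \<epsilon>\<^sub>o) * \<sigma> k + tail_cost N l V\<^sub>f k) \<and>
     (\<forall>k<N. tail_cost N l V\<^sub>f k \<le> \<gamma> (N - k) * \<sigma> k) \<and>
     (\<forall>k<N. (V - tail_cost N l V\<^sub>f 1) + tail_cost N l V\<^sub>f (Suc k) \<le> \<gamma> (N - k) * \<sigma> (Suc k)) \<and>
     V - tail_cost N l V\<^sub>f 1 \<le> \<epsilon>\<^sub>f * V\<^sub>f \<and>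
     c_lo * \<sigma> N \<le> V\<^sub>f \<and> V\<^sub>f \<le> c_up * \<sigma> N"
    (is "?L \<longleftrightarrow> ?R")
proof -
  have W: "(\<forall>k\<le>N. 0 \<le> \<sigma> k \<and> 0 \<le> W k) \<and> (\<forall>k\<le>N. 1 * \<sigma> k \<le> W k \<and> W k \<le> 1 * \<sigma> k)
      \<longleftrightarrow> (\<forall>k\<le>N. 0 \<le> \<sigma> k \<and> W k = \<sigma> k)"
    by force
  have dyn: "(\<forall>k<N. W (k + 1) - W k \<le> - \<epsilon>\<^sub>o * \<sigma> k + l k) \<longleftrightarrow>
      (\<forall>k<N. \<sigma> (Suc k) + tail_cost N l V\<^sub>f (Suc k) \<le> (1 - \<epsilon>\<^sub>o) * \<sigma> k + tail_cost N l V\<^sub>f k)"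
    if "\<forall>k\<le>N. 0 \<le> \<sigma> k \<and> W k = \<sigma> k"
  proof (intro all_cong1 imp_cong refl)
    fix k assume k: "k < N"
    then have "W (k + 1) = \<sigma> (Suc k)" "W k = \<sigma> k" using that by auto
    then show "(W (k + 1) - W k \<le> - \<epsilon>\<^sub>o * \<sigma> k + l k) \<longleftrightarrow>
      (\<sigma> (Suc k) + tail_cost N l V\<^sub>f (Suc k) \<le> (1 - \<epsilon>\<^sub>o) * \<sigma> k + tail_cost N l V\<^sub>f k)"
      using tail_cost_Suc[OF k, of l V\<^sub>f] by (simp add: left_diff_distrib) linarith
  qed
  have stage: "(\<forall>k\<in>{1..N}. V \<le> (\<Sum>j=1..<k. l j) + \<gamma> (N - k + 1) * \<sigma> k) \<longleftrightarrow>
      (\<forall>k<N. (V - tail_cost N l V\<^sub>f 1) + tail_cost N l V\<^sub>f (Suc k) \<le> \<gamma> (N - k) * \<sigma> (Suc k))"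
    (is "?A \<longleftrightarrow> ?B")
  proof -
    have "{1..N} = Suc ` {..<N}" by (simp add: lessThan_atLeast0 atLeastLessThanSuc_atLeastAtMost)
    then have "?A \<longleftrightarrow> (\<forall>k<N. V \<le> (\<Sum>j=1..<Suc k. l j) + \<gamma> (N - Suc k + 1) * \<sigma> (Suc k))"
      by (simp only: ball_simps(9)) (simp only: Ball_def lessThan_iff)
    also have "\<dots> \<longleftrightarrow> ?B"
    proof (intro all_cong1 imp_cong refl)
      fix k assume k: "k < N"
      then have "tail_cost N l V\<^sub>f 1 = (\<Sum>j=1..<Suc k. l j) + tail_cost N l V\<^sub>f (Suc k)"
        by (intro tail_cost_head) auto
      moreover have "N - Suc k + 1 = N - k" using k by simp
      ultimately show "(V \<le> (\<Sum>j=1..<Suc k. l j) + \<gamma> (N - Suc k + 1) * \<sigma> (Suc k)) \<longleftrightarrow>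
        ((V - tail_cost N l V\<^sub>f 1) + tail_cost N l V\<^sub>f (Suc k) \<le> \<gamma> (N - k) * \<sigma> (Suc k))"
        by (simp only:) (rule iffI; linarith)
    qed
    finally show ?thesis .
  qed
  have final: "V \<le> (\<Sum>j=1..<N. l j) + (1 + \<epsilon>\<^sub>f) * V\<^sub>f \<longleftrightarrow> V - tail_cost N l V\<^sub>f 1 \<le> \<epsilon>\<^sub>f * V\<^sub>f"
    by (simp add: tail_cost_def algebra_simps)
  show ?thesis
    unfolding lp_feasible_def stage final tail_cost_def[of N l V\<^sub>f k for k, symmetric]
    using W dyn by argo
qed

text \<open>Since \<open>\<sigma> \<ge> 0\<close>, a larger \<open>\<gamma>\<close> relaxes each constraint in which it occurs.\<close>

lemma lp_feasible_mono:
  assumes "\<And>k. 1 \<le> k \<Longrightarrow> \<gamma> k \<le> \<gamma>' k"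
    and "lp_feasible N \<epsilon>\<^sub>o go_lo go_up \<gamma> c_lo c_up \<epsilon>\<^sub>f l W \<sigma> V V\<^sub>f"
  shows "lp_feasible N \<epsilon>\<^sub>o go_lo go_up \<gamma>' c_lo c_up \<epsilon>\<^sub>f l W \<sigma> V V\<^sub>f"
proof -
  note F = assms(2)[unfolded lp_feasible_def]
  have 1: "\<gamma> (N - k) * \<sigma> k \<le> \<gamma>' (N - k) * \<sigma> k" if "k < N" for k
    using assms that by (intro mult_right_mono) (auto simp: lp_feasible_def)
  have 2: "\<gamma> (N - k + 1) * \<sigma> k \<le> \<gamma>' (N - k + 1) * \<sigma> k" if "k \<in> {1..N}" for k
    using assms that by (intro mult_right_mono) (auto simp: lp_feasible_def)
  show ?thesis
    unfolding lp_feasible_def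
  proof (intro conjI allI ballI impI)
    fix k assume k: "k < N"
    then have "(\<Sum>j=k..<N. l j) + V\<^sub>f \<le> \<gamma> (N - k) * \<sigma> k" using F by blast
    then show "(\<Sum>j=k..<N. l j) + V\<^sub>f \<le> \<gamma>' (N - k) * \<sigma> k" using 1[OF k] by linarith
  next
    fix k assume k: "k \<in> {1..N}"
    then have "V \<le> (\<Sum>j=1..<k. l j) + \<gamma> (N - k + 1) * \<sigma> k" using F by blast
    then show "V \<le> (\<Sum>j=1..<k. l j) + \<gamma>' (N - k + 1) * \<sigma> k" using 2[OF k] by linarith
  qed (use F in blast)+
qed

section \<open>The upper bound on the gap\<close>

text \<open>
  Adding \<open>\<epsilon>\<^sub>o\<close> times the slack of \<open>D + S \<le> g \<sigma>\<close> to the left-hand side turns it into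
  \<open>(\<sigma> + S + D) (1 - \<epsilon>\<^sub>o + g)\<close>, and there \<open>\<sigma> + S \<le> P\<close> applies. The shift by \<open>D\<close> makes the
  resulting recursion homogeneous: \<open>-D\<close> is the fixed point of
  \<open>P \<mapsto> ((1 - \<epsilon>\<^sub>o + g) P - \<epsilon>\<^sub>o D) / (1 + g)\<close> for every \<open>g\<close>.
\<close>

lemma contraction_step:
  fixes g \<epsilon>\<^sub>o \<sigma> S D P :: real
  assumes "0 \<le> g" "0 \<le> \<epsilon>\<^sub>o" "\<epsilon>\<^sub>o \<le> 1" and "\<sigma> + S \<le> P" and "D + S \<le> g * \<sigma>"
  shows "((1 - \<epsilon>\<^sub>o) * \<sigma> + S + D) * (1 + g) \<le> (P + D) * (1 - \<epsilon>\<^sub>o + g)"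
proof -
  have "((1 - \<epsilon>\<^sub>o) * \<sigma> + S + D) * (1 + g) + \<epsilon>\<^sub>o * (g * \<sigma> - (D + S)) = (\<sigma> + S + D) * (1 - \<epsilon>\<^sub>o + g)"
    by (simp add: algebra_simps)
  moreover have "(\<sigma> + S + D) * (1 - \<epsilon>\<^sub>o + g) \<le> (P + D) * (1 - \<epsilon>\<^sub>o + g)"
    using assms by (intro mult_right_mono) auto
  moreover have "0 \<le> \<epsilon>\<^sub>o * (g * \<sigma> - (D + S))"
    using assms by simp
  ultimately show ?thesis by linarith
qed

text \<open>
  The iterated contraction, closed by the terminal constraint \<open>D \<le> \<epsilon>\<^sub>f V\<^sub>f\<close>. In this
  product form it is linear in \<open>D\<close>; the same inequality serves for variable \<open>\<gamma>\<close>, where it is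
  solved for \<open>D\<close>, and for the constant majorant, where it is only compared with \<open>\<epsilon>\<^sub>o\<close>.
\<close>

lemma feasible_gap_inequality:
  assumes N: "1 \<le> N" and eps: "0 \<le> \<epsilon>\<^sub>o" "\<epsilon>\<^sub>o \<le> 1" and epsf: "0 \<le> \<epsilon>\<^sub>f"
    and \<gamma>: "\<And>k. 1 \<le> k \<Longrightarrow> 0 \<le> \<gamma> k"
    and feas: "lp_feasible N \<epsilon>\<^sub>o 1 1 \<gamma> c_lo c_up \<epsilon>\<^sub>f l W \<sigma> V V\<^sub>f"
  defines "D \<equiv> V - tail_cost N l V\<^sub>f 1"
  shows "D * (1 + \<epsilon>\<^sub>f) * (\<Prod>j<N. 1 + \<gamma> (N - j)) \<le>
         \<epsilon>\<^sub>f * \<gamma> 1 * (\<gamma> N + (1 - \<epsilon>\<^sub>o) + D) * (\<Prod>j<N-1. 1 - \<epsilon>\<^sub>o + \<gamma> (N - j))"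
proof -
  let ?S = "tail_cost N l V\<^sub>f"
  define P where "P k = (1 - \<epsilon>\<^sub>o) * \<sigma> k + ?S k" for k
  note F = feas[unfolded lp_feasible_iff[OF N], folded D_def]
  have dyn: "\<sigma> (Suc k) + ?S (Suc k) \<le> P k" if "k < N" for k
    using F that by (simp add: P_def)
  have val: "D + ?S (Suc k) \<le> \<gamma> (N - k) * \<sigma> (Suc k)" if "k < N" for k
    using F that by simp
  have step: "(P (Suc k) + D) * (1 + \<gamma> (N - k)) \<le> (P k + D) * (1 - \<epsilon>\<^sub>o + \<gamma> (N - k))"
    if "k < N" for k
    unfolding P_def[of "Suc k"] using that
    by (intro contraction_step eps \<gamma> dyn val) auto
  have iter: "(P n + D) * (\<Prod>j<n. 1 + \<gamma> (N - j)) \<le>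
      (\<gamma> N + (1 - \<epsilon>\<^sub>o) + D) * (\<Prod>j<n. 1 - \<epsilon>\<^sub>o + \<gamma> (N - j))" if "n \<le> N" for n
    using that
  proof (induction n)
    case 0
    have "?S 0 \<le> \<gamma> N" using F N by (metis diff_zero less_eq_Suc_le mult.right_neutral One_nat_def)
    then show ?case using F by (simp add: P_def)
  next
    case (Suc n)
    let ?A = "\<Prod>j<n. 1 + \<gamma> (N - j)" and ?B = "\<Prod>j<n. 1 - \<epsilon>\<^sub>o + \<gamma> (N - j)"
    have "0 \<le> ?A" using Suc.prems by (intro prod_nonneg) (simp add: \<gamma>)
    then have "(P (Suc n) + D) * (1 + \<gamma> (N - n)) * ?A \<le> (P n + D) * (1 - \<epsilon>\<^sub>o + \<gamma> (N - n)) * ?A"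
      using step Suc.prems by (intro mult_right_mono) auto
    moreover have "(P n + D) * ?A * (1 - \<epsilon>\<^sub>o + \<gamma> (N - n)) \<le>
        (\<gamma> N + (1 - \<epsilon>\<^sub>o) + D) * ?B * (1 - \<epsilon>\<^sub>o + \<gamma> (N - n))"
      using Suc eps \<gamma>[of "N - n"] by (intro mult_right_mono) auto
    ultimately show ?case by (simp add: mult_ac)
  qed
  obtain m where m: "N = Suc m" using N by (cases N) auto
  let ?A = "\<Prod>j<m. 1 + \<gamma> (N - j)" and ?B = "\<Prod>j<m. 1 - \<epsilon>\<^sub>o + \<gamma> (N - j)"
  have g1: "0 \<le> \<gamma> 1" by (simp add: \<gamma>)
  have A: "0 \<le> ?A" using m by (intro prod_nonneg) (simp add: \<gamma>)
  have last: "D * (1 + \<epsilon>\<^sub>f) * (1 + \<gamma> 1) \<le> \<epsilon>\<^sub>f * \<gamma> 1 * (P m + D)"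
  proof -
    have "D + V\<^sub>f \<le> \<gamma> 1 * \<sigma> N" "\<sigma> N + V\<^sub>f \<le> P m"
      using val[of m] dyn[of m] m by auto
    then have "D + V\<^sub>f + \<gamma> 1 * V\<^sub>f \<le> \<gamma> 1 * P m"
      using mult_left_mono[OF \<open>\<sigma> N + V\<^sub>f \<le> P m\<close> g1] by (simp add: algebra_simps)
    then have "\<epsilon>\<^sub>f * (D + V\<^sub>f + \<gamma> 1 * V\<^sub>f) \<le> \<epsilon>\<^sub>f * (\<gamma> 1 * P m)"
      using epsf by (rule mult_left_mono)
    moreover have "D * (1 + \<gamma> 1) \<le> \<epsilon>\<^sub>f * V\<^sub>f * (1 + \<gamma> 1)"
      using F g1 by (intro mult_right_mono) auto
    ultimately show ?thesis by (simp add: algebra_simps)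
  qed
  have "D * (1 + \<epsilon>\<^sub>f) * (1 + \<gamma> 1) * ?A \<le> \<epsilon>\<^sub>f * \<gamma> 1 * (P m + D) * ?A"
    using last A by (rule mult_right_mono)
  also have "\<dots> = \<epsilon>\<^sub>f * \<gamma> 1 * ((P m + D) * ?A)" by simp
  also have "\<dots> \<le> \<epsilon>\<^sub>f * \<gamma> 1 * ((\<gamma> N + (1 - \<epsilon>\<^sub>o) + D) * ?B)"
    using iter[of m] m epsf g1 by (intro mult_left_mono) auto
  finally show ?thesis using m by (simp add: mult_ac)
qed

text \<open>
  The coefficient of \<open>D\<close> after collecting terms in the gap inequality is positive: each
  factor of the subtracted product is dominated by the corresponding factor of the first one,
  and \<open>\<epsilon>\<^sub>f \<gamma>\<^sub>1 < (1 + \<epsilon>\<^sub>f) (1 + \<gamma>\<^sub>1)\<close>.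
\<close>

lemma gap_denominator_pos:
  fixes \<gamma> :: "nat \<Rightarrow> real"
  assumes "1 \<le> N" and "0 \<le> \<eta>" "\<eta> \<le> 1" and "0 \<le> \<epsilon>\<^sub>f"
    and \<gamma>: "\<And>k. 1 \<le> k \<Longrightarrow> 0 \<le> \<gamma> k"
  shows "0 < (1 + \<epsilon>\<^sub>f) * (\<Prod>j<N. 1 + \<gamma> (N - j)) - \<epsilon>\<^sub>f * \<gamma> 1 * (\<Prod>j<N-1. \<eta> + \<gamma> (N - j))"
proof -
  obtain m where m: "N = Suc m" using assms(1) by (cases N) auto
  let ?A = "\<Prod>j<m. 1 + \<gamma> (N - j)" and ?B = "\<Prod>j<m. \<eta> + \<gamma> (N - j)"
  have g: "0 \<le> \<gamma> (N - j)" if "j < m" for j using that m by (intro \<gamma>) auto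
  have g1: "0 \<le> \<gamma> 1" by (simp add: \<gamma>)
  have A: "0 < ?A" using g by (intro prod_pos) (auto intro: add_pos_nonneg)
  have BA: "?B \<le> ?A" using g assms by (intro prod_mono) auto
  have "\<epsilon>\<^sub>f * \<gamma> 1 * ?B \<le> \<epsilon>\<^sub>f * \<gamma> 1 * ?A"
    using BA g1 assms by (intro mult_left_mono) auto
  also have "\<dots> < (1 + \<epsilon>\<^sub>f) * (1 + \<gamma> 1) * ?A"
    using g1 assms(4) A by (intro mult_strict_right_mono) (auto simp: algebra_simps)
  finally show ?thesis using m by (simp add: mult_ac)
qed

section \<open>Existence of the minimum\<close>

text \<open>
  Setting all variables except \<open>\<sigma>\<^sub>0\<close> to zero gives a feasible point of value \<open>0\<close>, so only points of
  nonpositive value compete for the minimum. For these all variables lie in one interval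
  \<open>[0, B]\<close>: \<open>S\<^sub>0 \<le> \<gamma>\<^sub>N\<close> bounds \<open>l\<close> and \<open>V\<^sub>f\<close>, the dynamics give \<open>\<sigma>\<^sub>k \<le> 1 + l\<^sub>0 + \<dots> + l\<^sub>k\<^sub>-\<^sub>1\<close>,
  the terminal constraint bounds \<open>V\<close> above, and a nonpositive value means \<open>V \<ge> S\<^sub>1 \<ge> 0\<close>.
  The feasible points in this box, whose sequences carry the product topology, form a
  compact set, on which the continuous objective attains its minimum.
\<close>

lemma lp_values_attains_min:
  assumes N: "1 \<le> N" and eps: "0 \<le> \<epsilon>\<^sub>o" "\<epsilon>\<^sub>o \<le> 1" and epsf: "0 \<le> \<epsilon>\<^sub>f"
    and \<gamma>: "\<And>k. 1 \<le> k \<Longrightarrow> 0 \<le> \<gamma> k"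
  obtains v where "v \<in> lp_values N \<epsilon>\<^sub>o 1 1 \<gamma> c_lo c_up \<epsilon>\<^sub>f"
    and "\<And>w. w \<in> lp_values N \<epsilon>\<^sub>o 1 1 \<gamma> c_lo c_up \<epsilon>\<^sub>f \<Longrightarrow> v \<le> w"
proof -
  let ?feas = "lp_feasible N \<epsilon>\<^sub>o 1 1 \<gamma> c_lo c_up \<epsilon>\<^sub>f"
  define B where "B = (1 + \<epsilon>\<^sub>f) * (1 + \<gamma> N)"
  have gN: "0 \<le> \<gamma> N" using N by (rule \<gamma>)
  have B: "1 + \<gamma> N \<le> B" "(1 + \<epsilon>\<^sub>f) * \<gamma> N \<le> B"
    using epsf gN by (auto simp: B_def algebra_simps)
  have B1: "1 \<le> B" using B gN by linarith
  define C :: "((nat \<Rightarrow> real) \<times> (nat \<Rightarrow> real) \<times> real \<times> real) set"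
    where "C = {x. ?feas (fst x) (fst (snd x)) (fst (snd x)) (fst (snd (snd x))) (snd (snd (snd x)))}"
  define Box :: "(nat \<Rightarrow> real) set" where "Box = (\<Pi>\<^sub>E i\<in>UNIV. {0..B})"
  define K where "K = (Box \<times> Box \<times> {0..B} \<times> {0..B}) \<inter> C"
  define obj :: "(nat \<Rightarrow> real) \<times> (nat \<Rightarrow> real) \<times> real \<times> real \<Rightarrow> real"
    where "obj x = (\<Sum>k=1..<N. fst x k) + snd (snd (snd x)) - fst (snd (snd x))" for x
  have "compactin (product_topology (\<lambda>i. euclidean) UNIV) Box"
    unfolding Box_def compactin_PiE by auto
  then have "compact Box" by (simp add: euclidean_product_topology)
  have "closed C"
    unfolding C_def lp_feasible_def Ball_def
    by (intro closed_Collect_conj closed_Collect_all closed_Collect_imp open_Collect_const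
        closed_Collect_le closed_Collect_eq continuous_intros
        continuous_on_product_then_coordinatewise)
  have "compact K"
    unfolding K_def using \<open>compact Box\<close> \<open>closed C\<close>
    by (intro compact_Int_closed compact_Times) auto
  have cont: "continuous_on K obj"
    unfolding obj_def by (intro continuous_intros continuous_on_product_then_coordinatewise)
  \<comment> \<open>Third and fourth component are \<open>V\<close> and \<open>V\<^sub>f\<close>; \<open>W = \<sigma>\<close> has been eliminated.\<close>
  have zero: "((\<lambda>_. 0), (\<lambda>k. if k = 0 then 1 else 0), 0, 0) \<in> K"
    using B1 N eps \<gamma>
    by (auto simp: K_def Box_def C_def lp_feasible_def)
  obtain x where x: "x \<in> K" "\<And>y. y \<in> K \<Longrightarrow> obj x \<le> obj y"
    using continuous_attains_inf[OF \<open>compact K\<close> _ cont] zero by blast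
  show ?thesis
  proof (rule that[of "obj x"])
    show "obj x \<in> lp_values N \<epsilon>\<^sub>o 1 1 \<gamma> c_lo c_up \<epsilon>\<^sub>f"
      using x(1) unfolding K_def C_def lp_values_def obj_def by blast
    fix w assume "w \<in> lp_values N \<epsilon>\<^sub>o 1 1 \<gamma> c_lo c_up \<epsilon>\<^sub>f"
    then obtain l W \<sigma> V V\<^sub>f where feas: "?feas l W \<sigma> V V\<^sub>f"
      and w: "w = (\<Sum>k=1..<N. l k) + V\<^sub>f - V"
      by (auto simp: lp_values_def)
    show "obj x \<le> w"
    proof (cases "w \<le> 0")
      case False
      then show ?thesis using x(2)[OF zero] by (simp add: obj_def)
    next
      case True
      note F = feas[unfolded lp_feasible_def]
      have S0: "(\<Sum>j<N. l j) + V\<^sub>f \<le> \<gamma> N"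
        using F N by (metis atLeast0LessThan diff_zero less_eq_Suc_le mult.right_neutral One_nat_def)
      have l0: "0 \<le> l k" if "k < N" for k using F that by blast
      have Vf0: "0 \<le> V\<^sub>f" using F by blast
      have lsub: "sum l A \<le> (\<Sum>j<N. l j)" if "A \<subseteq> {..<N}" for A
        using that l0 by (intro sum_mono2) auto
      have l_le: "l k \<le> B" if "k < N" for k
        using lsub[of "{k}"] that S0 Vf0 B by simp
      have \<sigma>_le': "\<sigma> k \<le> 1 + (\<Sum>j<k. l j)" if "k \<le> N" for k
        using that
      proof (induction k)
        case 0 then show ?case using F by simp
      next
        case (Suc k)
        have "W (Suc k) - W k \<le> - \<epsilon>\<^sub>o * \<sigma> k + l k" "W (Suc k) = \<sigma> (Suc k)" "W k = \<sigma> k" "0 \<le> \<sigma> k"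
          using F Suc.prems by (auto intro: antisym)
        moreover have "0 \<le> \<epsilon>\<^sub>o * \<sigma> k" using \<open>0 \<le> \<sigma> k\<close> eps by simp
        ultimately show ?case using Suc by simp
      qed
      have \<sigma>_le: "\<sigma> k \<le> B" if "k \<le> N" for k
        using \<sigma>_le'[OF that] lsub[of "{..<k}"] that S0 Vf0 B by auto
      have Vf_le: "V\<^sub>f \<le> \<gamma> N" using lsub[of "{}"] S0 by simp
      have S1: "(\<Sum>k=1..<N. l k) + V\<^sub>f \<le> \<gamma> N" using lsub[of "{1..<N}"] S0 by fastforce
      have "0 \<le> (\<Sum>k=1..<N. l k)" using l0 by (intro sum_nonneg) auto
      then have V0: "0 \<le> V" using True w Vf0 by linarith
      have "\<epsilon>\<^sub>f * V\<^sub>f \<le> \<epsilon>\<^sub>f * \<gamma> N" using Vf_le epsf by (rule mult_left_mono)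
      then have V_le: "V \<le> B" using F S1 B by (simp add: algebra_simps)
      \<comment> \<open>Values outside the index ranges may be arbitrary; cutting them off puts the point
        into the box without changing feasibility or the objective.\<close>
      define l' where "l' k = (if k < N then l k else 0)" for k
      define \<sigma>' where "\<sigma>' k = (if k \<le> N then \<sigma> k else 0)" for k
      have sl: "(\<Sum>j=k..<n. l' j) = (\<Sum>j=k..<n. l j)" if "n \<le> N" for k n
        using that by (intro sum.cong) (auto simp: l'_def)
      have W: "W k = \<sigma> k" if "k \<le> N" for k using F that by (auto intro: antisym)
      have "?feas l' \<sigma>' \<sigma>' V V\<^sub>f"
        using F by (auto simp: lp_feasible_def sl W l'_def \<sigma>'_def)
      then have "(l', \<sigma>', V, V\<^sub>f) \<in> K"
        using l0 l_le F \<sigma>_le V0 V_le Vf0 Vf_le B gN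
        by (auto simp: K_def C_def Box_def l'_def \<sigma>'_def)
      from x(2)[OF this] show ?thesis by (simp add: obj_def sl w)
    qed
  qed
qed

lemma lp_min_attained:
  assumes "1 \<le> N" and "0 \<le> \<epsilon>\<^sub>o" "\<epsilon>\<^sub>o \<le> 1" and "0 \<le> \<epsilon>\<^sub>f" and "\<And>k. 1 \<le> k \<Longrightarrow> 0 \<le> \<gamma> k"
  shows "lp_min N \<epsilon>\<^sub>o 1 1 \<gamma> c_lo c_up \<epsilon>\<^sub>f \<in> lp_values N \<epsilon>\<^sub>o 1 1 \<gamma> c_lo c_up \<epsilon>\<^sub>f"
    and "w \<in> lp_values N \<epsilon>\<^sub>o 1 1 \<gamma> c_lo c_up \<epsilon>\<^sub>f \<Longrightarrow> lp_min N \<epsilon>\<^sub>o 1 1 \<gamma> c_lo c_up \<epsilon>\<^sub>f \<le> w"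
proof -
  obtain v where v: "v \<in> lp_values N \<epsilon>\<^sub>o 1 1 \<gamma> c_lo c_up \<epsilon>\<^sub>f"
    "\<And>w. w \<in> lp_values N \<epsilon>\<^sub>o 1 1 \<gamma> c_lo c_up \<epsilon>\<^sub>f \<Longrightarrow> v \<le> w"
    using lp_values_attains_min[where \<gamma>=\<gamma>, OF assms] by metis
  then have "lp_min N \<epsilon>\<^sub>o 1 1 \<gamma> c_lo c_up \<epsilon>\<^sub>f = v"
    unfolding lp_min_def by (intro Least_equality) auto
  with v show "lp_min N \<epsilon>\<^sub>o 1 1 \<gamma> c_lo c_up \<epsilon>\<^sub>f \<in> lp_values N \<epsilon>\<^sub>o 1 1 \<gamma> c_lo c_up \<epsilon>\<^sub>f"
    and "w \<in> lp_values N \<epsilon>\<^sub>o 1 1 \<gamma> c_lo c_up \<epsilon>\<^sub>f \<Longrightarrow> lp_min N \<epsilon>\<^sub>o 1 1 \<gamma> c_lo c_up \<epsilon>\<^sub>f \<le> w"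
    by auto
qed

section \<open>Sharpness for constant coefficients\<close>

text \<open>
  For constant \<open>\<gamma> = g\<close> the equality case of the contraction is \<open>P\<^sub>k + D = r\<^bsup>k\<^esup> (\<eta> + g + D)\<close>
  with \<open>r = (\<eta> + g) / (1 + g)\<close>. Equality in the dynamics and the value bounds then gives
  \<open>\<sigma>\<^sub>k = A r\<^bsup>k-1\<^esup>\<close> and \<open>S\<^sub>k = g \<sigma>\<^sub>k - D\<close> for \<open>k \<ge> 1\<close>, while \<open>S\<^sub>0 = g\<close>. The equation assumed
  for \<open>D\<close> says precisely that \<open>D = \<epsilon>\<^sub>f S\<^sub>N\<close>. Hence \<open>V\<^sub>f = S\<^sub>N = g \<sigma>\<^sub>N / (1 + \<epsilon>\<^sub>f)\<close>, which is
  the reason for the assumption on \<open>c_lo\<close> and \<open>c_up\<close>.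
\<close>

lemma constant_bound_attained:
  fixes g \<epsilon>\<^sub>o \<epsilon>\<^sub>f c_lo c_up D :: real
  assumes N: "1 \<le> N" and eps: "0 \<le> \<epsilon>\<^sub>o" "\<epsilon>\<^sub>o \<le> 1" and epsf: "0 < \<epsilon>\<^sub>f" and g: "0 \<le> g"
    and \<gamma>: "\<And>k. 1 \<le> k \<Longrightarrow> \<gamma> k = g"
    and c: "c_lo \<le> g / (1 + \<epsilon>\<^sub>f)" "g / (1 + \<epsilon>\<^sub>f) \<le> c_up"
    and D0: "0 \<le> D"
    and D: "D * (1 + \<epsilon>\<^sub>f) * (1 + g) ^ N = \<epsilon>\<^sub>f * g * (g + (1 - \<epsilon>\<^sub>o) + D) * (1 - \<epsilon>\<^sub>o + g) ^ (N - 1)"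
  shows "- D \<in> lp_values N \<epsilon>\<^sub>o 1 1 \<gamma> c_lo c_up \<epsilon>\<^sub>f"
proof -
  define r where "r = (1 - \<epsilon>\<^sub>o + g) / (1 + g)"
  define A where "A = (1 - \<epsilon>\<^sub>o + g + D) / (1 + g)"
  define \<sigma> where "\<sigma> k = (if k = 0 then 1 else A * r ^ (k - 1))" for k
  define S where "S k = (if k = 0 then g else g * A * r ^ (k - 1) - D)" for k
  define l where "l k = S k - S (Suc k)" for k
  have r: "0 \<le> r" "r \<le> 1" "(1 + g) * r = 1 - \<epsilon>\<^sub>o + g"
    using eps g by (auto simp: r_def field_simps)
  have A: "0 \<le> A" "(1 + g) * A = 1 - \<epsilon>\<^sub>o + g + D"
    using eps g D0 by (auto simp: A_def)
  have \<sigma>0: "0 \<le> \<sigma> k" for k using A r by (simp add: \<sigma>_def)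
  have SN: "D = \<epsilon>\<^sub>f * S N"
  proof -
    obtain m where m: "N = Suc m" using N by (cases N) auto
    have "D * (1 + \<epsilon>\<^sub>f) * (1 + g) ^ N = \<epsilon>\<^sub>f * g * ((1 + g) * A) * ((1 + g) * r) ^ m"
      using D m by (simp add: A r add_ac)
    also have "\<dots> = \<epsilon>\<^sub>f * g * A * r ^ m * (1 + g) ^ N"
      using m by (simp add: power_mult_distrib)
    finally have "D * (1 + \<epsilon>\<^sub>f) = \<epsilon>\<^sub>f * g * A * r ^ m"
      using g by simp
    then show ?thesis using m by (simp add: S_def algebra_simps)
  qed
  have SN0: "0 \<le> S N"
    using SN D0 epsf by (simp add: zero_le_mult_iff)
  have S: "tail_cost N l (S N) k = S k" if "k \<le> N" for k
    using that
  proof (induction rule: inc_induct)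
    case base show ?case by simp
  next
    case (step n) then show ?case by (simp add: tail_cost_Suc l_def)
  qed
  have l0: "0 \<le> l k" for k
  proof (cases k)
    case 0
    have "(1 + g) * l k = g * \<epsilon>\<^sub>o + D"
      using arg_cong[OF A(2), of "\<lambda>x. g * x"] 0 by (simp add: l_def S_def algebra_simps)
    also have "0 \<le> \<dots>" using g eps D0 by simp
    finally show ?thesis using g by (simp add: zero_le_mult_iff)
  next
    case (Suc i)
    then have "l k = g * A * r ^ i * (1 - r)" by (simp add: l_def S_def algebra_simps)
    then show ?thesis using g A r by simp
  qed
  have val: "D + S (Suc k) = g * \<sigma> (Suc k)" for k by (simp add: S_def \<sigma>_def)
  have dyn: "\<sigma> (Suc k) + S (Suc k) = (1 - \<epsilon>\<^sub>o) * \<sigma> k + S k" for k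
  proof (cases k)
    case 0
    then show ?thesis using A(2) by (simp add: \<sigma>_def S_def algebra_simps)
  next
    case (Suc i)
    have "\<sigma> (Suc k) + S (Suc k) = A * r ^ i * ((1 + g) * r) - D"
      using Suc by (simp add: \<sigma>_def S_def algebra_simps)
    also have "\<dots> = (1 - \<epsilon>\<^sub>o) * \<sigma> k + S k"
      unfolding r(3) using Suc by (simp add: \<sigma>_def S_def algebra_simps)
    finally show ?thesis .
  qed
  have S_le: "S k \<le> g * \<sigma> k" for k
    using val[of "k - 1"] D0 by (cases k) (auto simp: S_def \<sigma>_def)
  have "(1 + \<epsilon>\<^sub>f) * S N = g * \<sigma> N"
    using val[of "N - 1"] SN N by (simp add: algebra_simps)
  then have SN_eq: "S N = g / (1 + \<epsilon>\<^sub>f) * \<sigma> N"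
    using epsf by (simp add: field_simps)
  have "lp_feasible N \<epsilon>\<^sub>o 1 1 \<gamma> c_lo c_up \<epsilon>\<^sub>f l \<sigma> \<sigma> (S 1 + D) (S N)"
    unfolding lp_feasible_iff[OF N]
  proof (intro conjI allI impI)
    show "c_lo * \<sigma> N \<le> S N" "S N \<le> c_up * \<sigma> N"
      unfolding SN_eq using c \<sigma>0 by (intro mult_right_mono; simp)+
  next
    fix k assume k: "k < N"
    show "\<sigma> (Suc k) + tail_cost N l (S N) (Suc k) \<le> (1 - \<epsilon>\<^sub>o) * \<sigma> k + tail_cost N l (S N) k"
      using k dyn[of k] by (simp add: S)
    show "tail_cost N l (S N) k \<le> \<gamma> (N - k) * \<sigma> k"
      using k S_le[of k] by (simp add: S \<gamma>)
    show "S 1 + D - tail_cost N l (S N) 1 + tail_cost N l (S N) (Suc k) \<le> \<gamma> (N - k) * \<sigma> (Suc k)"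
      using k val[of k] by (simp add: S \<gamma>)
  next
    show "S 1 + D - tail_cost N l (S N) 1 \<le> \<epsilon>\<^sub>f * S N"
      using N SN by (simp add: S)
  qed (use \<sigma>0 l0 SN0 in \<open>auto simp: \<sigma>_def\<close>)
  moreover have "- D = (\<Sum>k=1..<N. l k) + S N - (S 1 + D)"
    using S[of 1] N by (simp add: tail_cost_def)
  ultimately show ?thesis
    unfolding lp_values_def by blast
qed

section \<open>The horizon bound and the theorem\<close>

text \<open>
  The bound on \<open>N\<close> is the logarithm of
  \<open>g (1 - \<epsilon>\<^sub>o + g)\<^bsup>N-1\<^esup> < \<epsilon>\<^sub>o (1 + 1/\<epsilon>\<^sub>f) (1 + g)\<^bsup>N-1\<^esup>\<close>; its denominator is positive because
  \<open>\<epsilon>\<^sub>o > 0\<close>.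
\<close>

lemma horizon_condition_imp_power_less:
  fixes g \<epsilon>\<^sub>o \<epsilon>\<^sub>f :: real
  assumes N: "1 \<le> N" and eps: "0 < \<epsilon>\<^sub>o" "\<epsilon>\<^sub>o < 1" and epsf: "0 < \<epsilon>\<^sub>f" and g: "0 < g"
    and h: "real N > 1 + (ln g - ln \<epsilon>\<^sub>o - ln (1 + 1 / \<epsilon>\<^sub>f)) / (ln (1 + g) - ln (g + (1 - \<epsilon>\<^sub>o)))"
  shows "\<epsilon>\<^sub>f * g * (1 - \<epsilon>\<^sub>o + g) ^ (N - 1) < \<epsilon>\<^sub>o * (1 + \<epsilon>\<^sub>f) * (1 + g) ^ (N - 1)"
proof -
  have pos: "0 < 1 - \<epsilon>\<^sub>o + g" "0 < 1 + 1 / \<epsilon>\<^sub>f" using eps g epsf by (auto intro: add_pos_pos)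
  have "0 < ln (1 + g) - ln (g + (1 - \<epsilon>\<^sub>o))" using eps g by simp
  with h have "ln g - ln \<epsilon>\<^sub>o - ln (1 + 1 / \<epsilon>\<^sub>f) < (real N - 1) * (ln (1 + g) - ln (g + (1 - \<epsilon>\<^sub>o)))"
    by (metis less_diff_eq add.commute pos_divide_less_eq)
  then have "ln g + real (N - 1) * ln (1 - \<epsilon>\<^sub>o + g) < ln \<epsilon>\<^sub>o + ln (1 + 1 / \<epsilon>\<^sub>f) + real (N - 1) * ln (1 + g)"
    using N by (simp add: algebra_simps of_nat_diff)
  then have "ln (g * (1 - \<epsilon>\<^sub>o + g) ^ (N - 1)) < ln (\<epsilon>\<^sub>o * (1 + 1 / \<epsilon>\<^sub>f) * (1 + g) ^ (N - 1))"
    using pos g eps by (simp add: ln_mult ln_realpow)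
  then have "g * (1 - \<epsilon>\<^sub>o + g) ^ (N - 1) < \<epsilon>\<^sub>o * (1 + 1 / \<epsilon>\<^sub>f) * (1 + g) ^ (N - 1)"
    using pos g eps by (subst (asm) ln_less_cancel_iff) auto
  then have "\<epsilon>\<^sub>f * (g * (1 - \<epsilon>\<^sub>o + g) ^ (N - 1)) < \<epsilon>\<^sub>f * (\<epsilon>\<^sub>o * (1 + 1 / \<epsilon>\<^sub>f) * (1 + g) ^ (N - 1))"
    using epsf by simp
  also have "\<dots> = \<epsilon>\<^sub>o * (1 + \<epsilon>\<^sub>f) * (1 + g) ^ (N - 1)"
    using epsf by (simp add: field_simps)
  finally show ?thesis by (simp add: mult_ac)
qed

theorem theorem8:
  fixes N :: nat and \<epsilon>\<^sub>o \<eta> \<gamma>_bar c_lo c_up \<epsilon>\<^sub>f go_lo go_up \<alpha> \<alpha>_hat :: real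
    and \<gamma> :: "nat \<Rightarrow> real"
  assumes "N \<ge> 1"
    and "0 < \<epsilon>\<^sub>o" and "\<epsilon>\<^sub>o < 1"
    and "\<eta> = 1 - \<epsilon>\<^sub>o"
    and "\<gamma>_bar \<ge> 0"
    and "\<forall>k\<ge>1. 0 \<le> \<gamma> k \<and> \<gamma> k \<le> \<gamma>_bar"
    and "c_lo > 0" and "c_up > 0" and "\<epsilon>\<^sub>f > 0"
    and "c_lo \<le> \<gamma> 1 / (1 + \<epsilon>\<^sub>f)" and "\<gamma> 1 / (1 + \<epsilon>\<^sub>f) \<le> c_up"
    and "go_lo = 1" and "go_up = 1"
    and "(\<alpha> - 1) * \<epsilon>\<^sub>o = lp_min N \<epsilon>\<^sub>o go_lo go_up \<gamma> c_lo c_up \<epsilon>\<^sub>f"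
    and "(1 - \<alpha>_hat) * \<epsilon>\<^sub>o =
           (\<epsilon>\<^sub>f * \<gamma> 1 * (\<gamma> N + \<eta>) * (\<Prod>j<N-1. \<eta> + \<gamma> (N - j))) /
           ((1 + \<epsilon>\<^sub>f) * (\<Prod>j<N. 1 + \<gamma> (N - j)) - \<epsilon>\<^sub>f * \<gamma> 1 * (\<Prod>j<N-1. \<eta> + \<gamma> (N - j)))"
  shows "(1 - \<alpha>) * \<epsilon>\<^sub>o \<le> (1 - \<alpha>_hat) * \<epsilon>\<^sub>o \<and>
         (real N > 1 + (ln \<gamma>_bar - ln \<epsilon>\<^sub>o - ln (1 + 1 / \<epsilon>\<^sub>f)) / (ln (1 + \<gamma>_bar) - ln (\<gamma>_bar + \<eta>))
            \<longrightarrow> \<alpha> > 0) \<and>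
         ((\<forall>k\<ge>1. \<gamma> k = \<gamma>_bar) \<longrightarrow> \<alpha>_hat = \<alpha>)"
proof -
  have N: "1 \<le> N" and eps: "0 \<le> \<epsilon>\<^sub>o" "\<epsilon>\<^sub>o \<le> 1" and epsf: "0 \<le> \<epsilon>\<^sub>f"
    using assms by auto
  have \<gamma>: "0 \<le> \<gamma> k" if "1 \<le> k" for k using assms(6) that by blast
  \<comment> \<open>The lower constant \<open>c_lo\<close> is positive, so \<open>\<gamma> 1\<close> is, and with it \<open>\<gamma>_bar\<close>; its logarithm is
    therefore meaningful.\<close>
  have "0 < \<gamma> 1 / (1 + \<epsilon>\<^sub>f)" using assms by linarith
  then have g1: "0 < \<gamma> 1" using epsf by (simp add: zero_less_divide_iff)
  then have g: "0 < \<gamma>_bar" using assms(6) by (meson less_le_trans order_refl)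
  have \<eta>: "\<eta> = 1 - \<epsilon>\<^sub>o" by fact
  define A B where "A = (\<Prod>j<N. 1 + \<gamma> (N - j))" and "B = (\<Prod>j<N-1. \<eta> + \<gamma> (N - j))"
  have den: "0 < (1 + \<epsilon>\<^sub>f) * A - \<epsilon>\<^sub>f * \<gamma> 1 * B"
    unfolding A_def B_def using N eps epsf \<gamma> \<eta> by (intro gap_denominator_pos) auto
  note min = lp_min_attained[where \<gamma>=\<gamma> and c_lo=c_lo and c_up=c_up, OF N eps epsf \<gamma>]
  have lpm: "lp_min N \<epsilon>\<^sub>o 1 1 \<gamma> c_lo c_up \<epsilon>\<^sub>f = - ((1 - \<alpha>) * \<epsilon>\<^sub>o)"
    using assms(12-14) by (simp add: algebra_simps)
  obtain l W \<sigma> V V\<^sub>f where feas: "lp_feasible N \<epsilon>\<^sub>o 1 1 \<gamma> c_lo c_up \<epsilon>\<^sub>f l W \<sigma> V V\<^sub>f"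
    and opt: "- ((1 - \<alpha>) * \<epsilon>\<^sub>o) = (\<Sum>k=1..<N. l k) + V\<^sub>f - V"
    using min(1) unfolding lpm lp_values_def by auto
  define D where "D = (1 - \<alpha>) * \<epsilon>\<^sub>o"
  define D' where "D' = (1 - \<alpha>_hat) * \<epsilon>\<^sub>o"
  have D: "V - tail_cost N l V\<^sub>f 1 = D" using opt by (simp add: tail_cost_def D_def)
  have D': "D' = \<epsilon>\<^sub>f * \<gamma> 1 * (\<gamma> N + \<eta>) * B / ((1 + \<epsilon>\<^sub>f) * A - \<epsilon>\<^sub>f * \<gamma> 1 * B)"
    unfolding D'_def A_def B_def by (rule assms(15))
  have i: "D \<le> D'"
  proof -
    have "D * (1 + \<epsilon>\<^sub>f) * A \<le> \<epsilon>\<^sub>f * \<gamma> 1 * (\<gamma> N + \<eta> + D) * B"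
      using feasible_gap_inequality[where \<gamma>=\<gamma>, OF N eps epsf \<gamma> feas] unfolding D A_def B_def \<eta> by simp
    then show ?thesis unfolding D' using den by (simp add: pos_le_divide_eq algebra_simps)
  qed
  have ii: "0 < \<alpha>"
    if h: "real N > 1 + (ln \<gamma>_bar - ln \<epsilon>\<^sub>o - ln (1 + 1 / \<epsilon>\<^sub>f)) / (ln (1 + \<gamma>_bar) - ln (\<gamma>_bar + \<eta>))"
  proof -
    let ?q = "(1 - \<epsilon>\<^sub>o + \<gamma>_bar) ^ (N - 1)"
    have "lp_feasible N \<epsilon>\<^sub>o 1 1 (\<lambda>_. \<gamma>_bar) c_lo c_up \<epsilon>\<^sub>f l W \<sigma> V V\<^sub>f"
      using assms(6) feas by (intro lp_feasible_mono[of \<gamma> "\<lambda>_. \<gamma>_bar"]) auto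
    from feasible_gap_inequality[OF N eps epsf _ this] g
    have gap: "D * (1 + \<epsilon>\<^sub>f) * (1 + \<gamma>_bar) ^ N \<le> \<epsilon>\<^sub>f * \<gamma>_bar * (\<gamma>_bar + (1 - \<epsilon>\<^sub>o) + D) * ?q"
      unfolding D by simp
    have less: "\<epsilon>\<^sub>f * \<gamma>_bar * ?q < \<epsilon>\<^sub>o * (1 + \<epsilon>\<^sub>f) * (1 + \<gamma>_bar) ^ (N - 1)"
      using N assms(2,3,9) g h unfolding \<eta> by (rule horizon_condition_imp_power_less)
    have "D < \<epsilon>\<^sub>o"
    proof (rule ccontr)
      assume "\<not> D < \<epsilon>\<^sub>o"
      then have "\<epsilon>\<^sub>o \<le> D" by simp
      \<comment> \<open>With \<open>D \<ge> \<epsilon>\<^sub>o\<close> the factor \<open>\<gamma>_bar + (1 - \<epsilon>\<^sub>o) + D\<close> of the gap inequality is at most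
        \<open>D (1 + \<gamma>_bar) / \<epsilon>\<^sub>o\<close>, so cancelling \<open>D (1 + \<gamma>_bar)\<close> contradicts the power inequality.\<close>
      have "\<epsilon>\<^sub>f * \<gamma>_bar * ?q * (\<epsilon>\<^sub>o * (\<gamma>_bar + (1 - \<epsilon>\<^sub>o) + D)) \<le> \<epsilon>\<^sub>f * \<gamma>_bar * ?q * (D * (1 + \<gamma>_bar))"
      proof (intro mult_left_mono)
        have "D * (1 + \<gamma>_bar) - \<epsilon>\<^sub>o * (\<gamma>_bar + (1 - \<epsilon>\<^sub>o) + D) = (D - \<epsilon>\<^sub>o) * (\<gamma>_bar + (1 - \<epsilon>\<^sub>o))"
          by (simp add: algebra_simps)
        also have "\<dots> \<ge> 0" using \<open>\<epsilon>\<^sub>o \<le> D\<close> g eps by simp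
        finally show "\<epsilon>\<^sub>o * (\<gamma>_bar + (1 - \<epsilon>\<^sub>o) + D) \<le> D * (1 + \<gamma>_bar)" by simp
      qed (use epsf g eps in auto)
      also have "\<dots> < \<epsilon>\<^sub>o * (1 + \<epsilon>\<^sub>f) * (1 + \<gamma>_bar) ^ (N - 1) * (D * (1 + \<gamma>_bar))"
        using less \<open>\<epsilon>\<^sub>o \<le> D\<close> assms(2) g by (intro mult_strict_right_mono) auto
      also have "\<dots> = \<epsilon>\<^sub>o * (D * (1 + \<epsilon>\<^sub>f) * (1 + \<gamma>_bar) ^ N)"
        using N by (cases N) auto
      also have "\<dots> \<le> \<epsilon>\<^sub>o * (\<epsilon>\<^sub>f * \<gamma>_bar * (\<gamma>_bar + (1 - \<epsilon>\<^sub>o) + D) * ?q)"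
        using gap eps(1) by (rule mult_left_mono)
      finally show False by (simp add: mult_ac)
    qed
    then show ?thesis using assms(2) by (simp add: D_def)
  qed
  have iii: "\<alpha>_hat = \<alpha>" if const: "\<forall>k\<ge>1. \<gamma> k = \<gamma>_bar"
  proof -
    have \<gamma>N: "\<gamma> 1 = \<gamma>_bar" "\<gamma> N = \<gamma>_bar" using const N by auto
    have A: "A = (1 + \<gamma>_bar) ^ N"
      unfolding A_def using const by simp
    have B: "B = (\<eta> + \<gamma>_bar) ^ (N - 1)"
      unfolding B_def using const by simp
    have "0 \<le> B" unfolding B using \<eta> eps g by simp
    then have D'0: "0 \<le> D'" unfolding D' using den epsf g1 \<gamma>[OF N] \<eta> eps by simp
    have "D' * ((1 + \<epsilon>\<^sub>f) * A - \<epsilon>\<^sub>f * \<gamma> 1 * B) = \<epsilon>\<^sub>f * \<gamma> 1 * (\<gamma> N + \<eta>) * B"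
      unfolding D' using den by simp
    then have "D' * (1 + \<epsilon>\<^sub>f) * A = \<epsilon>\<^sub>f * \<gamma>_bar * (\<gamma>_bar + (1 - \<epsilon>\<^sub>o) + D') * B"
      unfolding \<gamma>N \<eta> by (simp add: algebra_simps)
    then have "D' * (1 + \<epsilon>\<^sub>f) * (1 + \<gamma>_bar) ^ N =
        \<epsilon>\<^sub>f * \<gamma>_bar * (\<gamma>_bar + (1 - \<epsilon>\<^sub>o) + D') * (1 - \<epsilon>\<^sub>o + \<gamma>_bar) ^ (N - 1)"
      unfolding A B \<eta> .
    then have "- D' \<in> lp_values N \<epsilon>\<^sub>o 1 1 \<gamma> c_lo c_up \<epsilon>\<^sub>f"
      using N eps assms(9-11) g const \<gamma>N(1) D'0 by (intro constant_bound_attained) auto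
    then have "D' \<le> D" using min(2) unfolding lpm D_def by fastforce
    with i have "D' = D" by simp
    then show ?thesis using assms(2) by (simp add: D_def D'_def)
  qed
  show ?thesis using i ii iii by (simp add: D_def D'_def)
qed

end
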